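(* Let $F$ be a probability measure on $\mathbb R\cup\{-\infty\}$ with $\inf\{z:F((z,\infty))=0\}=1$, and let $\ell\in[0,1)$ be such that $F([1-\ell,1])>0$ and $F([\ell,1])>0$. Let $w(t)=(w_1(t),w_2(t),\ldots)$, $t\in\mathbb Z$, where $w_j(t)$, $j\in\mathbb N$, $t\in\mathbb Z$, are i.i.d. with distribution $F$. Define $$T^*:=\sup\Big\{t\le-1:\ w_1(t)\ge\ell,\ \min_{1\le j\le|t|}\overline w(t;j)\ge1-\ell\Big\}.$$ Then $|T^*|<\infty$ a.s., and $$\bar{\mathfrak m}(0)=\mathfrak m\Big(\sigma\,\Psi_{w(-1)}\circ\cdots\circ\Psi_{w(T^*+1)}\delta_0,\ w(0)\Big)\quad\text{a.s.}$$
   Context: $\mathcal N$ is the set of locally finite point measures $\nu$ on $\mathbb R\cup\{-\infty\}$ with $\nu([0,\infty))<\infty$; $\nu_1\ge\nu_2\ge\cdots$ are the locations of the points of $\nu$ in decreasing order. For $\nu\neq0$ and a sequence $w=(w_1,w_2,\ldots)$ in $\mathbb R\cup\{-\infty\}$ with $\sup_kw_k\le1$, let $\mathfrak m(\nu,w):=\sup_k(\nu_k+w_k)$ (sup over the indices of the points of $\nu$), $\Psi_w\nu:=\nu+\delta_{\mathfrak m(\nu,w)}$, and $\sigma\nu:=\sum_k\delta_{\nu_k-\nu_1}$. For $t\in\mathbb Z$ and $j\in\mathbb N$, $\overline w(t;j):=\max\{w_1(t+j),\ldots,w_j(t+j)\}$. An empty composition (when $T^*=-1$) is the identity. The stationary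 process $\bar{\mathfrak m}$: let $R_k:=\{w_1(k)\ge\ell\}\cap\bigcap_{j\ge1}\{\overline w(k;j)\ge1-\ell\}$ and $J:=\{k\in\mathbb Z:R_k\text{ holds}\}$, which is a.s. infinite in both directions; enumerate it as $\cdots<T_{-1}<T_0\le0<T_1<\cdots$. Set $\tilde\nu(T_i)=\delta_0$ and $\tilde\nu(t)=\sigma\,\Psi_{w(t)}\circ\cdots\circ\Psi_{w(T_i+1)}\delta_0$ for $T_i<t<T_{i+1}$, $i\in\mathbb Z$. Then $\bar{\mathfrak m}(t):=\mathfrak m(\sigma\tilde\nu(t-1),w(t))$, $t\in\mathbb Z$. *)

theory Defs
  imports "HOL-Probability.Probability"
begin

text \<open>
  Point measures on \<open>\<real> \<union> {-\<infinity>}\<close> are Borel measures on \<^typ>\<open>ereal\<close> that do not charge \<open>\<infinity>\<close> and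
  are sums of Dirac measures. Sequences \<open>w\<^sub>1, w\<^sub>2, \<dots>\<close> are functions on \<^typ>\<open>nat\<close> whose value at
  \<open>0\<close> is never used.
\<close>

definition dirac :: "ereal \<Rightarrow> ereal measure" where
  "dirac x = return borel x"

definition add_measure :: "ereal measure \<Rightarrow> ereal measure \<Rightarrow> ereal measure" where
  "add_measure \<mu> \<nu> = measure_of UNIV (sets borel) (\<lambda>A. emeasure \<mu> A + emeasure \<nu> A)"

definition indices :: "ereal measure \<Rightarrow> nat set" where
  "indices \<nu> = {k. 1 \<le> k \<and> of_nat k \<le> emeasure \<nu> UNIV}"

text \<open>
  The \<open>k\<close>-th largest point (with multiplicity), for \<open>k\<close> in \<^term>\<open>indices \<nu>\<close>, of a point measure
  with finite mass on each \<open>[a, \<infinity>)\<close>, \<open>a \<in> \<real>\<close>; see \<open>point_sum_dirac\<close> below.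
\<close>

definition point :: "ereal measure \<Rightarrow> nat \<Rightarrow> ereal" where
  "point \<nu> k = Sup {x. of_nat k \<le> emeasure \<nu> {x..}}"

definition max_shift :: "ereal measure \<Rightarrow> (nat \<Rightarrow> ereal) \<Rightarrow> ereal" where
  "max_shift \<nu> w = (SUP k\<in>indices \<nu>. point \<nu> k + w k)"

definition Psi :: "(nat \<Rightarrow> ereal) \<Rightarrow> ereal measure \<Rightarrow> ereal measure" where
  "Psi w \<nu> = add_measure \<nu> (dirac (max_shift \<nu> w))"

text \<open>
  The image of the counting measure on the index set under \<open>k \<mapsto> \<nu>\<^sub>k - \<nu>\<^sub>1\<close> is the sum of the Dirac
  measures at \<open>\<nu>\<^sub>k - \<nu>\<^sub>1\<close>.
\<close>

definition sigma_shift :: "ereal measure \<Rightarrow> ereal measure" where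
  "sigma_shift \<nu> = distr (count_space (indices \<nu>)) borel (\<lambda>k. point \<nu> k - point \<nu> 1)"

text \<open>
  \<open>\<Psi>\<^bsub>W(t)\<^esub> \<circ> \<dots> \<circ> \<Psi>\<^bsub>W(s+1)\<^esub>\<close>: the map with the smallest time is applied first, and the composition
  is the identity if \<open>t \<le> s\<close>.
\<close>

definition Psi_comp :: "(int \<Rightarrow> nat \<Rightarrow> ereal) \<Rightarrow> int \<Rightarrow> int \<Rightarrow> ereal measure \<Rightarrow> ereal measure" where
  "Psi_comp W s t = fold (\<lambda>u. Psi (W u)) [s + 1..t]"

definition wbar :: "(int \<Rightarrow> nat \<Rightarrow> ereal) \<Rightarrow> int \<Rightarrow> nat \<Rightarrow> ereal" where
  "wbar W t j = Max ((\<lambda>i. W (t + int j) i) ` {1..j})"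

definition renewal_times :: "(int \<Rightarrow> nat \<Rightarrow> ereal) \<Rightarrow> real \<Rightarrow> int set" where
  "renewal_times W l = {k. W k 1 \<ge> ereal l \<and> (\<forall>j\<ge>1. wbar W k j \<ge> ereal (1 - l))}"

text \<open>
  The enumeration \<open>\<dots> < T\<^sub>-\<^sub>1 < T\<^sub>0 \<le> 0 < T\<^sub>1 < \<dots>\<close>. It exists, and is then unique, iff the set is
  infinite in both directions; otherwise the value is unspecified.
\<close>

definition renewal_enum :: "(int \<Rightarrow> nat \<Rightarrow> ereal) \<Rightarrow> real \<Rightarrow> int \<Rightarrow> int" where
  "renewal_enum W l =
     (THE T. strict_mono T \<and> range T = renewal_times W l \<and> T 0 \<le> 0 \<and> 0 < T 1)"

definition nu_tilde :: "(int \<Rightarrow> nat \<Rightarrow> ereal) \<Rightarrow> real \<Rightarrow> int \<Rightarrow> ereal measure" where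
  "nu_tilde W l t =
     (let T = renewal_enum W l; i = (THE i. T i \<le> t \<and> t < T (i + 1))
      in if t = T i then dirac 0 else sigma_shift (Psi_comp W (T i) t (dirac 0)))"

definition m_bar :: "(int \<Rightarrow> nat \<Rightarrow> ereal) \<Rightarrow> real \<Rightarrow> int \<Rightarrow> ereal" where
  "m_bar W l t = max_shift (sigma_shift (nu_tilde W l (t - 1))) (W t)"

text \<open>An extended real: the supremum is \<open>-\<infinity>\<close> if no \<open>t\<close> qualifies.\<close>

definition T_star :: "(int \<Rightarrow> nat \<Rightarrow> ereal) \<Rightarrow> real \<Rightarrow> ereal" where
  "T_star W l =
     Sup {ereal (of_int t) |t. t \<le> -1 \<and> W t 1 \<ge> ereal l
            \<and> Min (wbar W t ` {1..nat \<bar>t\<bar>}) \<ge> ereal (1 - l)}"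

lemma sets_add_measure [simp]: "sets (add_measure \<mu> \<nu>) = sets borel"
  unfolding add_measure_def
  using sets.sigma_sets_eq[of "borel :: ereal measure"] by (subst sets_measure_of) auto

lemma emeasure_add_measure:
  assumes "sets \<mu> = sets borel" "sets \<nu> = sets borel" "A \<in> sets borel"
  shows "emeasure (add_measure \<mu> \<nu>) A = emeasure \<mu> A + emeasure \<nu> A"
proof (rule emeasure_measure_of[OF add_measure_def])
  show "countably_additive (sets (add_measure \<mu> \<nu>)) (\<lambda>A. emeasure \<mu> A + emeasure \<nu> A)"
    unfolding countably_additive_def
  proof (intro allI impI)
    fix B :: "nat \<Rightarrow> ereal set"
    assume "range B \<subseteq> sets (add_measure \<mu> \<nu>)" "disjoint_family B"
    then show "(\<Sum>i. emeasure \<mu> (B i) + emeasure \<nu> (B i)) = emeasure \<mu> (\<Union> (range B)) + emeasure \<nu> (\<Union> (range B))"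
      using assms by (simp add: suminf_add[symmetric] suminf_emeasure)
  qed
qed (use assms in \<open>auto simp: positive_def\<close>)

lemma point_sum_dirac:
  fixes x :: "nat \<Rightarrow> ereal"
  assumes dec: "\<And>i j. 1 \<le> i \<Longrightarrow> i \<le> j \<Longrightarrow> j \<le> n \<Longrightarrow> x j \<le> x i"
    and k: "k \<in> {1..n}"
  defines "\<nu> \<equiv> distr (count_space {1..n}) borel x"
  shows "indices \<nu> = {1..n}" and "point \<nu> k = x k"
proof -
  have em: "emeasure \<nu> A = of_nat (card {i\<in>{1..n}. x i \<in> A})" if "A \<in> sets borel" for A
  proof -
    have "emeasure \<nu> A = emeasure (count_space {1..n}) (x -` A \<inter> {1..n})"
      using that unfolding \<nu>_def by (subst emeasure_distr) auto
    also have "x -` A \<inter> {1..n} = {i\<in>{1..n}. x i \<in> A}"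
      by auto
    also have "emeasure (count_space {1..n}) \<dots> = of_nat (card {i\<in>{1..n}. x i \<in> A})"
      by (rule emeasure_count_space_finite) auto
    finally show ?thesis .
  qed
  have "emeasure \<nu> UNIV = of_nat (card {1..n})"
  proof -
    have "{i\<in>{1..n}. x i \<in> UNIV} = {1..n}"
      by auto
    then show ?thesis
      using em[of UNIV] by (simp only:) simp
  qed
  then show "indices \<nu> = {1..n}"
    unfolding indices_def by auto
  have "of_nat k \<le> emeasure \<nu> {y..} \<longleftrightarrow> y \<le> x k" for y
  proof
    assume "of_nat k \<le> emeasure \<nu> {y..}"
    then have le: "k \<le> card {i\<in>{1..n}. y \<le> x i}"
      by (simp add: em)
    show "y \<le> x k"
    proof (rule ccontr)
      assume "\<not> y \<le> x k"
      have "i < k" if "i \<in> {1..n}" "y \<le> x i" for i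
        using dec[of k i] k that \<open>\<not> y \<le> x k\<close> order_trans[of y "x i" "x k"]
        by (cases "k \<le> i") auto
      then have "{i\<in>{1..n}. y \<le> x i} \<subseteq> {1..<k}"
        by auto
      then have "card {i\<in>{1..n}. y \<le> x i} \<le> card {1..<k}"
        by (intro card_mono) auto
      then show False
        using le k by auto
    qed
  next
    assume "y \<le> x k"
    have "y \<le> x i" if "i \<in> {1..k}" for i
      using dec[of i k] k that \<open>y \<le> x k\<close> order_trans[of y "x k" "x i"] by auto
    then have "{1..k} \<subseteq> {i\<in>{1..n}. y \<le> x i}"
      using k by auto
    then have "card {1..k} \<le> card {i\<in>{1..n}. y \<le> x i}"
      by (intro card_mono) auto
    then show "of_nat k \<le> emeasure \<nu> {y..}"
      by (simp add: em)
  qed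
  then have "{y. of_nat k \<le> emeasure \<nu> {y..}} = {..x k}"
    by auto
  then show "point \<nu> k = x k"
    by (simp add: point_def)
qed

end

theory Submission
  imports Defs
begin

text \<open>
  Coupling at \<open>T\<^sup>*\<close>. Let \<open>s \<le> -1\<close> be the last renewal time before \<open>0\<close>; it satisfies the condition defining
  \<open>T\<^sup>*\<close>, so \<open>s \<le> T\<^sup>*\<close>. Start from \<open>\<delta>\<^sub>0\<close> at time \<open>s\<close>. Since \<open>w\<^sub>1(T\<^sup>*) \<ge> l\<close>, the point \<open>m\<close> inserted at time
  \<open>T\<^sup>*\<close> lies at least \<open>l\<close> above all older points, which can therefore never produce a point beyond
  \<open>m + 1 - l\<close>. As long as the \<open>j\<close> newest points, all \<open>\<ge> m\<close>, see a weight \<open>\<ge> 1 - l\<close> at time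
  \<open>T\<^sup>* + j\<close>, the maximum is attained among them. So the newer points evolve as the process started from
  \<open>\<delta>\<^sub>0\<close> at \<open>T\<^sup>*\<close>, translated by \<open>m\<close>, up to and including time \<open>0\<close>.

  Renewal times are a.s. unbounded in both directions: at the times \<open>k\<^sub>m = \<plusminus>(m + 1)\<^sup>2\<close>, the renewal
  conditions truncated to \<open>j \<le> m\<close> involve disjoint sets of rows, hence are independent, with probability
  bounded below by a multiple of \<open>\<Prod>\<^sub>j (1 - q\<^sup>j)\<close>, \<open>q = F([-\<infinity>, 1 - l))\<close>, while the omitted conditions fail with
  probability at most \<open>q\<^sup>m\<^sup>+\<^sup>1 / (1 - q)\<close>, which is summable.
  The Borel zero-one law gives infinitely many truncated renewals, and the first Borel--Cantelli lemma
  removes the truncation.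
\<close>

section \<open>Point measures as decreasing lists\<close>

text \<open>The point measures that occur have finitely many points, all of them real, so lists of
  reals suffice. In a decreasing list the entry at position \<open>k - 1\<close> is the
  \<open>k\<close>-th largest point.\<close>

definition pts :: "real list \<Rightarrow> ereal measure" where
  "pts xs = distr (count_space {1..length xs}) borel (\<lambda>k. ereal (xs ! (k - 1)))"

definition lead :: "real list \<Rightarrow> (nat \<Rightarrow> ereal) \<Rightarrow> ereal" where
  "lead xs w = (SUP k\<in>{1..length xs}. ereal (xs ! (k - 1)) + w k)"

text \<open>The key \<open>uminus\<close> keeps the list decreasing. Since
  \<open>real_of_ereal\<close> sends infinite values to 0, this represents \<open>Psi\<close> only
  where \<open>lead\<close> is finite.\<close>

definition add_lead :: "(nat \<Rightarrow> ereal) \<Rightarrow> real list \<Rightarrow> real list" where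
  "add_lead w xs = insort_key uminus (real_of_ereal (lead xs w)) xs"

fun evolve :: "(int \<Rightarrow> nat \<Rightarrow> ereal) \<Rightarrow> int \<Rightarrow> nat \<Rightarrow> real list" where
  "evolve W s 0 = [0]"
| "evolve W s (Suc n) = add_lead (W (s + int (Suc n))) (evolve W s n)"

lemma sets_pts [simp]: "sets (pts xs) = sets borel"
  by (simp add: pts_def)

text \<open>Passing to the multiset removes the order, so that inserting a value amounts to adding a
  Dirac mass.\<close>

lemma emeasure_pts:
  assumes "A \<in> sets borel"
  shows "emeasure (pts xs) A = of_nat (size {#x \<in># mset xs. ereal x \<in> A#})"
proof -
  let ?B = "{i. i < length xs \<and> ereal (xs ! i) \<in> A}"
  have eq: "(\<lambda>k. ereal (xs ! (k - 1))) -` A \<inter> {1..length xs} = Suc ` ?B"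
  proof (intro set_eqI iffI)
    fix k assume "k \<in> (\<lambda>k. ereal (xs ! (k - 1))) -` A \<inter> {1..length xs}"
    then show "k \<in> Suc ` ?B"
      by (intro image_eqI[of _ _ "k - 1"]) auto
  qed auto
  have "emeasure (pts xs) A = emeasure (count_space {1..length xs}) (Suc ` ?B)"
    using assms emeasure_distr[of "\<lambda>k. ereal (xs ! (k - 1))" "count_space {1..length xs}" borel A]
    unfolding pts_def space_count_space eq by simp
  also have "\<dots> = of_nat (card (Suc ` ?B))"
    by (intro emeasure_count_space_finite) auto
  also have "card (Suc ` ?B) = length (filter (\<lambda>x. ereal x \<in> A) xs)"
    by (simp add: card_image length_filter_conv_card)
  also have "\<dots> = size {#x \<in># mset xs. ereal x \<in> A#}"
    by (metis mset_filter size_mset)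
  finally show ?thesis .
qed

lemma dirac_0: "dirac 0 = pts [0]"
  by (rule measure_eqI) (auto simp: dirac_def emeasure_pts zero_ereal_def indicator_def)

lemma
  assumes "sorted_wrt (\<ge>) xs"
  shows indices_pts: "indices (pts xs) = {1..length xs}"
    and point_pts: "k \<in> {1..length xs} \<Longrightarrow> point (pts xs) k = ereal (xs ! (k - 1))"
proof -
  have *: "ereal (xs ! (j - 1)) \<le> ereal (xs ! (i - 1))"
    if "1 \<le> i" "i \<le> j" "j \<le> length xs" for i j
  proof (cases "i = j")
    case False
    then show ?thesis
      using that assms sorted_wrt_nth_less[of "(\<ge>)" xs "i - 1" "j - 1"] by auto
  qed auto
  \<comment> \<open>\<open>point_sum_dirac\<close> presupposes some index \<open>k\<close>, so the
    empty list is treated apart.\<close>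
  show "indices (pts xs) = {1..length xs}"
  proof (cases "xs = []")
    case True
    then show ?thesis by (auto simp: indices_def emeasure_pts)
  next
    case False
    then have "1 \<in> {1..length xs}" by (cases xs) auto
    from point_sum_dirac(1)[where x = "\<lambda>k. ereal (xs ! (k - 1))", OF * this] show ?thesis
      unfolding pts_def by blast
  qed
  show "point (pts xs) k = ereal (xs ! (k - 1))" if "k \<in> {1..length xs}"
    using point_sum_dirac(2)[where x = "\<lambda>k. ereal (xs ! (k - 1))", OF * that]
    unfolding pts_def by blast
qed

lemma max_shift_pts: "sorted_wrt (\<ge>) xs \<Longrightarrow> max_shift (pts xs) w = lead xs w"
  unfolding max_shift_def lead_def by (intro SUP_cong) (auto simp: indices_pts point_pts)

lemma sigma_shift_pts:
  assumes "sorted_wrt (\<ge>) xs"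
  shows "sigma_shift (pts xs) = pts (map (\<lambda>x. x - hd xs) xs)"
  unfolding sigma_shift_def pts_def[of "map _ _"]
proof (rule distr_cong)
  fix k assume "k \<in> space (count_space (indices (pts xs)))"
  then have k: "k \<in> {1..length xs}"
    using assms by (simp add: indices_pts)
  then have "1 \<in> {1..length xs}" and "xs \<noteq> []" and "k - 1 < length xs" by auto
  with k show "point (pts xs) k - point (pts xs) 1 = ereal (map (\<lambda>x. x - hd xs) xs ! (k - 1))"
    using assms by (simp add: indices_pts point_pts hd_conv_nth)
qed (use assms in \<open>auto simp: indices_pts\<close>)

lemma sorted_shift: "sorted_wrt (\<ge>) xs \<Longrightarrow> sorted_wrt (\<ge>) (map (\<lambda>x. x - c) xs)" for c :: real
  by (auto simp: sorted_wrt_map elim: sorted_wrt_mono_rel[rotated])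

text \<open>After one shift the head is 0, and a second shift subtracts nothing. This is needed
  because \<open>m_bar\<close> shifts \<open>nu_tilde\<close>, which is already shifted between
  renewal times.\<close>

lemma sigma_shift_idem:
  assumes "sorted_wrt (\<ge>) xs"
  shows "sigma_shift (sigma_shift (pts xs)) = sigma_shift (pts xs)"
proof -
  have "map (\<lambda>x. x - hd (map (\<lambda>x. x - hd xs) xs)) (map (\<lambda>x. x - hd xs) xs) = map (\<lambda>x. x - hd xs) xs"
    by (cases xs) auto
  then show ?thesis
    using assms by (simp only: sigma_shift_pts sorted_shift)
qed

lemma sorted_add_lead: "sorted_wrt (\<ge>) xs \<Longrightarrow> sorted_wrt (\<ge>) (add_lead w xs)"
  using sorted_insort_key[of uminus "real_of_ereal (lead xs w)" xs]
  by (simp add: add_lead_def sorted_wrt_map)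

lemma length_add_lead [simp]: "length (add_lead w xs) = Suc (length xs)"
  by (simp add: add_lead_def)

lemma Psi_pts:
  assumes "sorted_wrt (\<ge>) xs" and "\<bar>lead xs w\<bar> \<noteq> \<infinity>"
  shows "Psi w (pts xs) = pts (add_lead w xs)"
proof (rule measure_eqI)
  fix A assume "A \<in> sets (Psi w (pts xs))"
  then have "A \<in> sets borel" by (simp add: Psi_def)
  then show "emeasure (Psi w (pts xs)) A = emeasure (pts (add_lead w xs)) A"
    using assms
    by (auto simp: Psi_def emeasure_add_measure dirac_def max_shift_pts emeasure_pts add_lead_def
        ereal_real add.commute)
qed (simp add: Psi_def)

section \<open>Bounds, translation and localisation of the leading value\<close>

lemma lead_bounds:
  assumes "\<And>k. 1 \<le> k \<Longrightarrow> w k \<le> 1" and "\<And>x. x \<in> set xs \<Longrightarrow> a \<le> x \<and> x \<le> b"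
    and "\<exists>k\<in>{1..length xs}. ereal c \<le> w k"
  shows "ereal (a + c) \<le> lead xs w" and "lead xs w \<le> ereal (b + 1)" and "\<bar>lead xs w\<bar> \<noteq> \<infinity>"
proof -
  have nth: "a \<le> xs ! (k - 1) \<and> xs ! (k - 1) \<le> b" if "k \<in> {1..length xs}" for k
    using that by (intro assms(2) nth_mem) auto
  from assms(3) obtain k where k: "k \<in> {1..length xs}" "ereal c \<le> w k" by blast
  have "ereal (a + c) \<le> ereal (xs ! (k - 1)) + w k"
    using add_mono[OF _ k(2), of "ereal a" "ereal (xs ! (k - 1))"] nth[OF k(1)] by simp
  also have "\<dots> \<le> lead xs w"
    unfolding lead_def using k(1) by (intro SUP_upper)
  finally show 1: "ereal (a + c) \<le> lead xs w" .
  show 2: "lead xs w \<le> ereal (b + 1)"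
    unfolding lead_def
  proof (rule SUP_least)
    fix k assume k: "k \<in> {1..length xs}"
    have "ereal (xs ! (k - 1)) + w k \<le> ereal b + ereal 1"
      using nth[OF k] assms(1)[of k] k by (intro add_mono) (auto simp: one_ereal_def)
    then show "ereal (xs ! (k - 1)) + w k \<le> ereal (b + 1)" by simp
  qed
  show "\<bar>lead xs w\<bar> \<noteq> \<infinity>"
    using 1 2 by (cases "lead xs w") auto
qed

lemma lead_shift:
  assumes "xs \<noteq> []"
  shows "lead (map (\<lambda>x. x + c) xs) w = lead xs w + ereal c"
proof -
  have "lead (map (\<lambda>x. x + c) xs) w = (SUP k\<in>{1..length xs}. (ereal (xs ! (k - 1)) + w k) + ereal c)"
    unfolding lead_def by (intro SUP_cong) (auto simp: ac_simps simp flip: plus_ereal.simps(1))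
  also have "\<dots> = lead xs w + ereal c"
    unfolding lead_def using assms by (intro SUP_ereal_add_left) (auto simp: Suc_le_eq)
  finally show ?thesis .
qed

text \<open>Weights are at most 1, so a point of \<open>ys\<close> reaches at most
  \<open>a - l + 1 = a + (1 - l)\<close>, and some point of \<open>xs\<close> reaches at least that
  value. This is what makes the older points invisible.\<close>

lemma lead_append:
  assumes w: "\<And>k. 1 \<le> k \<Longrightarrow> w k \<le> 1" and xs: "\<And>x. x \<in> set xs \<Longrightarrow> a \<le> x"
    and ys: "\<And>y. y \<in> set ys \<Longrightarrow> y + l \<le> a"
    and big: "\<exists>k\<in>{1..length xs}. ereal (1 - l) \<le> w k"
  shows "lead (xs @ ys) w = lead xs w"
proof (rule antisym)
  show "lead (xs @ ys) w \<le> lead xs w"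
    unfolding lead_def[of "xs @ ys"]
  proof (rule SUP_least)
    fix k assume k: "k \<in> {1..length (xs @ ys)}"
    show "ereal ((xs @ ys) ! (k - 1)) + w k \<le> lead xs w"
    proof (cases "k \<le> length xs")
      case True
      with k have "k - 1 < length xs" by auto
      then have "(xs @ ys) ! (k - 1) = xs ! (k - 1)" by (simp add: nth_append)
      with True k show ?thesis unfolding lead_def by (auto intro!: SUP_upper2[of k])
    next
      case False
      with k have "(xs @ ys) ! (k - 1) \<in> set ys" by (auto simp: nth_append)
      then have "ereal ((xs @ ys) ! (k - 1)) + w k \<le> ereal (a - l) + ereal 1"
        using ys[of "(xs @ ys) ! (k - 1)"] w[of k] k by (intro add_mono) (auto simp: one_ereal_def)
      also have "\<dots> = ereal (a + (1 - l))" by simp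
      also from big obtain j where j: "j \<in> {1..length xs}" "ereal (1 - l) \<le> w j" by blast
      have "a \<le> xs ! (j - 1)"
        using j(1) by (intro xs nth_mem) auto
      then have "ereal (a + (1 - l)) \<le> ereal (xs ! (j - 1)) + w j"
        using add_mono[OF _ j(2), of "ereal a" "ereal (xs ! (j - 1))"] by simp
      also have "\<dots> \<le> lead xs w" unfolding lead_def using j(1) by (intro SUP_upper)
      finally show ?thesis .
    qed
  qed
  show "lead xs w \<le> lead (xs @ ys) w"
    unfolding lead_def by (rule SUP_mono) (force simp: nth_append)
qed

text \<open>\<open>insort_key\<close> puts a new value in front of those with an equal key, so
  \<open>m\<close> stops before \<open>ys\<close> even in case of a tie.\<close>

lemma insort_key_append_ge:
  assumes "\<And>y. y \<in> set ys \<Longrightarrow> y \<le> m"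
  shows "insort_key uminus (m::real) (xs @ ys) = insort_key uminus m xs @ ys"
  using assms by (induction xs) (cases ys, auto)

lemma insort_key_shift:
  "insort_key uminus (m + c) (map (\<lambda>x. x + c) xs) = map (\<lambda>x. x + c) (insort_key uminus m xs)" for m c :: real
  by (induction xs) auto

lemma set_add_lead: "set (add_lead w xs) = insert (real_of_ereal (lead xs w)) (set xs)"
  by (simp add: add_lead_def set_insort_key)

section \<open>Evolution from a single point and the coupling of two starting times\<close>

lemma length_evolve [simp]: "length (evolve W s n) = Suc n"
  by (induction n) auto

lemma sorted_evolve: "sorted_wrt (\<ge>) (evolve W s n)"
  by (induction n) (auto intro: sorted_add_lead)

text \<open>Before step \<open>j\<close> there are exactly \<open>j\<close> points, so the
  hypothesis gives one of them a weight of at least \<open>1 - l\<close>. Inductively, the new point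
  is at least \<open>0 + (1 - l)\<close>.\<close>

lemma evolve_nonneg:
  assumes w: "\<And>t k. 1 \<le> k \<Longrightarrow> W t k \<le> 1" and "l \<le> 1"
    and big: "\<And>j. 1 \<le> j \<Longrightarrow> j \<le> n \<Longrightarrow> \<exists>k\<in>{1..j}. ereal (1 - l) \<le> W (s + int j) k"
    and "x \<in> set (evolve W s n)"
  shows "0 \<le> x"
  using big assms(4)
proof (induction n arbitrary: x)
  case (Suc n)
  have nn: "0 \<le> x \<and> x \<le> Max (set (evolve W s n))" if "x \<in> set (evolve W s n)" for x
    using Suc that by auto
  have "ereal (0 + (1 - l)) \<le> lead (evolve W s n) (W (s + int (Suc n)))"
    using Suc.prems(1)[of "Suc n"] nn w by (intro lead_bounds(1)[where b = "Max (set (evolve W s n))"]) auto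
  moreover have "\<bar>lead (evolve W s n) (W (s + int (Suc n)))\<bar> \<noteq> \<infinity>"
    using Suc.prems(1)[of "Suc n"] nn w by (intro lead_bounds(3)[where a = 0 and b = "Max (set (evolve W s n))" and c = "1 - l"]) auto
  ultimately have "0 \<le> real_of_ereal (lead (evolve W s n) (W (s + int (Suc n))))"
    using \<open>l \<le> 1\<close> by (cases "lead (evolve W s n) (W (s + int (Suc n)))") auto
  then show ?case using Suc.prems(2) nn by (auto simp: set_add_lead)
qed auto

lemma lead_evolve_bounds:
  assumes w: "\<And>t k. 1 \<le> k \<Longrightarrow> W t k \<le> 1" and "l \<le> 1"
    and big: "\<And>j. 1 \<le> j \<Longrightarrow> j \<le> n \<Longrightarrow> \<exists>k\<in>{1..j}. ereal (1 - l) \<le> W (s + int j) k"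
    and "\<And>k. 1 \<le> k \<Longrightarrow> v k \<le> 1" "\<exists>k\<in>{1..Suc n}. ereal c \<le> v k"
  shows "\<bar>lead (evolve W s n) v\<bar> \<noteq> \<infinity>" and "ereal c \<le> lead (evolve W s n) v"
proof -
  have "0 \<le> x \<and> x \<le> Max (set (evolve W s n))" if "x \<in> set (evolve W s n)" for x
    using evolve_nonneg[OF w \<open>l \<le> 1\<close> big that] that by auto
  then show "\<bar>lead (evolve W s n) v\<bar> \<noteq> \<infinity>" "ereal c \<le> lead (evolve W s n) v"
    using lead_bounds[of v "evolve W s n" 0 "Max (set (evolve W s n))" c] assms(4,5) by auto
qed

text \<open>At every step some present point has a weight of at least \<open>1 - l\<close>, so
  \<open>lead\<close> stays finite and \<open>Psi_pts\<close> applies throughout.\<close>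

lemma Psi_comp_evolve:
  assumes w: "\<And>t k. 1 \<le> k \<Longrightarrow> W t k \<le> 1" and "l \<le> 1"
    and big: "\<And>j. 1 \<le> j \<Longrightarrow> j \<le> n \<Longrightarrow> \<exists>k\<in>{1..j}. ereal (1 - l) \<le> W (s + int j) k"
  shows "Psi_comp W s (s + int n) (dirac 0) = pts (evolve W s n)"
  using big
proof (induction n)
  case 0
  then show ?case by (simp add: Psi_comp_def dirac_0)
next
  case (Suc n)
  have "[s + 1..s + int (Suc n)] = [s + 1..s + int n] @ [s + int (Suc n)]"
    by (subst upto_rec2) (auto simp: algebra_simps)
  then have "Psi_comp W s (s + int (Suc n)) (dirac 0) = Psi (W (s + int (Suc n))) (pts (evolve W s n))"
    using Suc by (simp add: Psi_comp_def)
  also have "\<dots> = pts (evolve W s (Suc n))"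
    unfolding evolve.simps using Suc.prems Suc.prems[of "Suc n"]
    by (intro Psi_pts sorted_evolve lead_evolve_bounds(1)[OF w \<open>l \<le> 1\<close>, where c = "1 - l"] w) auto
  finally show ?case .
qed

text \<open>The point \<open>m\<close> arrives at time \<open>u\<close>, at least \<open>l\<close>
  above all older ones. From then on \<open>lead_append\<close> discards the older points,
  \<open>lead_shift\<close> carries the translation by \<open>m\<close> along, and each new point,
  being at least \<open>m\<close>, is inserted in front of the old list.\<close>

lemma evolve_coupling:
  fixes W :: "int \<Rightarrow> nat \<Rightarrow> ereal" and d n :: nat and s :: int and l :: real
  defines "u \<equiv> s + int (Suc d)"
  defines "m \<equiv> real_of_ereal (lead (evolve W s d) (W u))"
  assumes w: "\<And>t k. 1 \<le> k \<Longrightarrow> W t k \<le> 1" and l: "0 \<le> l" "l \<le> 1"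
    and ys: "\<And>y. y \<in> set (evolve W s d) \<Longrightarrow> y + l \<le> m"
    and big: "\<And>j. 1 \<le> j \<Longrightarrow> j \<le> n \<Longrightarrow> \<exists>k\<in>{1..j}. ereal (1 - l) \<le> W (u + int j) k"
  shows "evolve W s (Suc d + n) = map (\<lambda>x. x + m) (evolve W u n) @ evolve W s d"
  using big
proof (induction n)
  case 0
  have "y \<le> m" if "y \<in> set (evolve W s d)" for y
    using ys[OF that] l by linarith
  from insort_key_append_ge[of _ m "[]", OF this] show ?case
    by (simp add: add_lead_def m_def u_def)
next
  case (Suc n)
  let ?v = "W (u + int (Suc n))"
  have IH: "evolve W s (Suc d + n) = map (\<lambda>x. x + m) (evolve W u n) @ evolve W s d"
    using Suc.prems by (intro Suc.IH) auto
  have t: "s + int (Suc (Suc d + n)) = u + int (Suc n)" by (simp add: u_def)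
  have big': "\<exists>k\<in>{1..length (evolve W u n)}. ereal (1 - l) \<le> ?v k"
    using Suc.prems[of "Suc n"] by simp
  have nn: "0 \<le> x" if "x \<in> set (evolve W u n)" for x
    using evolve_nonneg[OF w l(2) _ that] Suc.prems by auto
  have lb: "\<bar>lead (evolve W u n) ?v\<bar> \<noteq> \<infinity>" "ereal (1 - l) \<le> lead (evolve W u n) ?v"
    using lead_evolve_bounds[where W = W and l = l and s = u and n = n and v = ?v and c = "1 - l"]
      Suc.prems big' w l by auto
  define r where "r = real_of_ereal (lead (evolve W u n) ?v)"
  have r: "lead (evolve W u n) ?v = ereal r" "0 \<le> r"
    using lb l by (auto simp: r_def ereal_real)
  have "lead (evolve W s (Suc d + n)) ?v = lead (map (\<lambda>x. x + m) (evolve W u n)) ?v"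
    unfolding IH
    by (rule lead_append[where a = m and l = l]) (use w nn ys big' in auto)
  also have "\<dots> = ereal (r + m)"
    by (subst lead_shift) (simp flip: length_0_conv, simp only: r plus_ereal.simps)
  finally have "evolve W s (Suc d + Suc n) = insort_key uminus (r + m) (evolve W s (Suc d + n))"
    by (simp only: add_Suc_right evolve.simps(2)[of W s "Suc d + n"] t add_lead_def real_of_ereal.simps)
  also have "\<dots> = insort_key uminus (r + m) (map (\<lambda>x. x + m) (evolve W u n)) @ evolve W s d"
    unfolding IH
    by (rule insort_key_append_ge) (use ys r l in force)
  also have "\<dots> = map (\<lambda>x. x + m) (evolve W u (Suc n)) @ evolve W s d"
    by (simp add: insort_key_shift add_lead_def r_def)
  finally show ?case .
qed

lemma wbar_ge_iff: "1 \<le> j \<Longrightarrow> c \<le> wbar W t j \<longleftrightarrow> (\<exists>k\<in>{1..j}. c \<le> W (t + int j) k)"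
  unfolding wbar_def by (subst Max_ge_iff) auto

text \<open>The two measures just before time 0 differ, as the run from \<open>s\<close> keeps its
  older points; it is the maximum with \<open>W 0\<close> that agrees. This is why the condition on
  \<open>u\<close> extends to \<open>j = \<bar>u\<bar>\<close>, which is the row of time 0.\<close>

lemma max_shift_renewal:
  assumes w: "\<And>t k. 1 \<le> k \<Longrightarrow> W t k \<le> 1" and l: "0 \<le> l" "l \<le> 1"
    and s: "s \<in> renewal_times W l" "s < u" and u: "u \<le> -1" "ereal l \<le> W u 1"
    and j: "\<And>j. j \<in> {1..nat \<bar>u\<bar>} \<Longrightarrow> ereal (1 - l) \<le> wbar W u j"
  shows "max_shift (sigma_shift (Psi_comp W s (-1) (dirac 0))) (W 0) =
    max_shift (sigma_shift (Psi_comp W u (-1) (dirac 0))) (W 0)"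
proof -
  \<comment> \<open>\<open>d\<close> counts the times strictly between \<open>s\<close> and
    \<open>u\<close>, and \<open>n\<close> the times from \<open>u + 1\<close> to
    \<open>-1\<close>.\<close>
  define d n where "d = nat (u - s - 1)" and "n = nat (- 1 - u)"
  have d: "u = s + int (Suc d)" and n: "u + int n = - 1" "s + int (Suc d + n) = - 1"
    using s(2) u(1) by (auto simp: d_def n_def)
  have bigs: "\<exists>k\<in>{1..j}. ereal (1 - l) \<le> W (s + int j) k" if "1 \<le> j" for j
    using s(1) that by (auto simp: renewal_times_def wbar_ge_iff)
  have bigu: "\<exists>k\<in>{1..j}. ereal (1 - l) \<le> W (u + int j) k" if "1 \<le> j" "j \<le> Suc n" for j
    using j[of j] that u(1) by (simp add: wbar_ge_iff n_def)
  let ?A = "evolve W u n" and ?Y = "evolve W s d"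
  define m where "m = real_of_ereal (lead ?Y (W u))"
  have m: "lead ?Y (W u) = ereal m"
  proof -
    have "\<bar>lead ?Y (W u)\<bar> \<noteq> \<infinity>"
      using u(2) bigs by (intro lead_evolve_bounds(1)[OF w l(2), where c = l] w) auto
    then show ?thesis by (auto simp: m_def ereal_real)
  qed
  have Y: "y + l \<le> m" if "y \<in> set ?Y" for y
  proof -
    have "y \<le> hd ?Y"
      using that sorted_evolve[of W s d] by (cases ?Y) auto
    moreover have "ereal (hd ?Y + l) \<le> ereal m"
    proof -
      have ne: "?Y \<noteq> []" by (simp flip: length_0_conv)
      have "ereal (hd ?Y) + ereal l \<le> ereal (?Y ! (1 - 1)) + W u 1"
        using u(2) ne by (intro add_mono) (auto simp: hd_conv_nth)
      also have "\<dots> \<le> lead ?Y (W u)"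
        unfolding lead_def by (intro SUP_upper) auto
      finally show ?thesis by (simp add: m)
    qed
    ultimately show ?thesis by simp
  qed
  have split: "evolve W s (Suc d + n) = map (\<lambda>x. x + m) ?A @ ?Y"
    unfolding m_def d
  proof (rule evolve_coupling[OF w l])
    show "y + l \<le> real_of_ereal (lead ?Y (W (s + int (Suc d))))" if "y \<in> set ?Y" for y
      using Y[OF that] by (simp add: m_def d)
    show "\<exists>k\<in>{1..j}. ereal (1 - l) \<le> W (s + int (Suc d) + int j) k" if "1 \<le> j" "j \<le> n" for j
      using bigu[of j] that by (simp add: d)
  qed
  have "?A \<noteq> []" by (simp flip: length_0_conv)
  then have hd: "hd (map (\<lambda>x. x + m) ?A @ ?Y) = hd ?A + m"
    by (simp add: hd_map)
  have P: "Psi_comp W s (- 1) (dirac 0) = pts (map (\<lambda>x. x + m) ?A @ ?Y)"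
    using Psi_comp_evolve[OF w l(2) bigs, of "Suc d + n"] unfolding n(2) split .
  have Q: "Psi_comp W u (- 1) (dirac 0) = pts ?A"
    using Psi_comp_evolve[of W l n u] w l bigu n by auto
  have sorted: "sorted_wrt (\<ge>) (map (\<lambda>x. x + m) ?A @ ?Y)"
    using sorted_evolve[of W s "Suc d + n"] by (simp only: split)
  have "max_shift (sigma_shift (Psi_comp W s (- 1) (dirac 0))) (W 0) =
      lead (map (\<lambda>x. x - hd ?A) ?A @ map (\<lambda>x. x - (hd ?A + m)) ?Y) (W 0)"
    unfolding P sigma_shift_pts[OF sorted] max_shift_pts[OF sorted_shift[OF sorted]] hd
    by (simp add: comp_def)
  \<comment> \<open>After centring at the top point \<open>hd ?A + m\<close>, the newer points are
    at least \<open>- hd ?A\<close> and the older ones at most \<open>- hd ?A - l\<close>.\<close>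
  also have "\<dots> = lead (map (\<lambda>x. x - hd ?A) ?A) (W 0)"
  proof (rule lead_append[where a = "- hd ?A" and l = l])
    show "- hd ?A \<le> x" if "x \<in> set (map (\<lambda>x. x - hd ?A) ?A)" for x
      using that evolve_nonneg[of W l n u] w l bigu by force
    show "y + l \<le> - hd ?A" if "y \<in> set (map (\<lambda>x. x - (hd ?A + m)) ?Y)" for y
      using that Y by force
    show "\<exists>k\<in>{1..length (map (\<lambda>x. x - hd ?A) ?A)}. ereal (1 - l) \<le> W 0 k"
      using bigu[of "Suc n"] n(1) by (simp add: algebra_simps)
  qed (use w in auto)
  also have "\<dots> = max_shift (sigma_shift (Psi_comp W u (- 1) (dirac 0))) (W 0)"
    unfolding Q by (simp add: sigma_shift_pts sorted_evolve max_shift_pts sorted_shift)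
  finally show ?thesis .
qed

section \<open>Enumeration of the renewal times\<close>

text \<open>Positive and non-positive elements are enumerated separately as infinite sets of
  naturals, with \<open>k > 0\<close> coded by \<open>k - 1\<close> and \<open>k \<le> 0\<close> by
  \<open>- k\<close>. Index 0 then carries the largest non-positive element.\<close>

lemma int_enumeration_exists:
  fixes J :: "int set"
  assumes above: "\<And>n. \<exists>k\<in>J. n < k" and below: "\<And>n. \<exists>k\<in>J. k < n"
  obtains T where "strict_mono T" "range T = J" "T 0 \<le> (0::int)" "0 < T (1::int)"
proof -
  define P where "P = {n. int n + 1 \<in> J}"
  define N where "N = {n. - int n \<in> J}"
  have P: "infinite P"
    unfolding infinite_nat_iff_unbounded
  proof
    fix m
    obtain k where "k \<in> J" "int m + 1 < k" using above by blast
    then show "\<exists>n>m. n \<in> P"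
      by (intro exI[of _ "nat (k - 1)"]) (auto simp: P_def)
  qed
  have N: "infinite N"
    unfolding infinite_nat_iff_unbounded
  proof
    fix m
    obtain k where "k \<in> J" "k < - int m" using below by blast
    then show "\<exists>n>m. n \<in> N"
      by (intro exI[of _ "nat (- k)"]) (auto simp: N_def)
  qed
  define T where "T i = (if 0 < i then int (enumerate P (nat (i - 1))) + 1 else - int (enumerate N (nat (- i))))" for i
  show ?thesis
  proof
    show "strict_mono T"
    proof (rule strict_monoI)
      fix i j :: int assume "i < j"
      then consider "0 < i" | "i \<le> 0" "0 < j" | "j \<le> 0" by linarith
      then show "T i < T j"
      proof cases
        case 1
        then show ?thesis using \<open>i < j\<close> enumerate_mono[OF _ P, of "nat (i - 1)" "nat (j - 1)"]
          by (simp add: T_def)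
      next
        case 3
        then show ?thesis using \<open>i < j\<close> enumerate_mono[OF _ N, of "nat (- j)" "nat (- i)"]
          by (simp add: T_def)
      qed (simp add: T_def)
    qed
    show "range T = J"
    proof (intro equalityI subsetI)
      fix k assume "k \<in> range T"
      then obtain i where "k = T i" by blast
      then show "k \<in> J"
        using enumerate_in_set[OF P, of "nat (i - 1)"] enumerate_in_set[OF N, of "nat (- i)"]
        by (auto simp: T_def P_def N_def split: if_splits)
    next
      fix k assume k: "k \<in> J"
      show "k \<in> range T"
      proof (cases "0 < k")
        case True
        with k have "nat (k - 1) \<in> range (enumerate P)"
          by (subst range_enumerate[OF P]) (simp add: P_def)
        then obtain n where "nat (k - 1) = enumerate P n" by blast
        with True have "k = T (int n + 1)" by (simp add: T_def)
        then show ?thesis by blast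
      next
        case False
        with k have "nat (- k) \<in> range (enumerate N)"
          by (subst range_enumerate[OF N]) (simp add: N_def)
        then obtain n where "nat (- k) = enumerate N n" by blast
        with False have "k = T (- int n)" by (simp add: T_def)
        then show ?thesis by blast
      qed
    qed
  qed (auto simp: T_def)
qed

text \<open>\<open>T 0\<close> must be the largest non-positive element of the range, and from there
  neighbouring values are forced in both directions.\<close>

lemma int_enumeration_unique:
  fixes T T' :: "int \<Rightarrow> int"
  assumes "strict_mono T" "T 0 \<le> 0" "0 < T 1" and "strict_mono T'" "T' 0 \<le> 0" "0 < T' 1"
    and "range T = range T'"
  shows "T = T'"
proof
  fix i
  \<comment> \<open>This and the next two facts are one-sided inequalities; each is used with both
    orders of \<open>T\<close> and \<open>T'\<close>.\<close>
  have zero: "S 0 \<le> S' 0"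
    if S: "S 0 \<le> 0" "range S = range S'" "strict_mono S'" "0 < S' 1" for S S' :: "int \<Rightarrow> int"
  proof -
    obtain j where j: "S 0 = S' j" using S(2) by blast
    then have "S' j < S' 1" using S by simp
    then have "j \<le> 0" using strict_mono_less[OF S(3)] by fastforce
    then show ?thesis using j strict_mono_less_eq[OF S(3)] by simp
  qed
  have up: "S (i + 1) \<le> S' (i + 1)"
    if S: "S i = S' i" "range S = range S'" "strict_mono S" "strict_mono S'" for S S' :: "int \<Rightarrow> int" and i
  proof -
    obtain j where j: "S' (i + 1) = S j" using S(2) by (metis rangeI image_iff)
    have "S i < S j" using S(1) j strict_mono_less[OF S(4), of i "i + 1"] by simp
    then have "i + 1 \<le> j" using strict_mono_less[OF S(3)] by fastforce
    then show ?thesis using j strict_mono_less_eq[OF S(3)] by simp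
  qed
  have down: "S (i - 1) \<ge> S' (i - 1)"
    if S: "S i = S' i" "range S = range S'" "strict_mono S" "strict_mono S'" for S S' :: "int \<Rightarrow> int" and i
  proof -
    obtain j where j: "S' (i - 1) = S j" using S(2) by (metis rangeI image_iff)
    have "S j < S i" using S(1) j strict_mono_less[OF S(4), of "i - 1" i] by simp
    then have "j \<le> i - 1" using strict_mono_less[OF S(3)] by fastforce
    then show ?thesis using j strict_mono_less_eq[OF S(3)] by simp
  qed
  show "T i = T' i"
  proof (induction i rule: int_induct[where k = 0])
    case base
    show ?case using zero[of T T'] zero[of T' T] assms by simp
  next
    case (step1 i)
    then show ?case using up[of T i T'] up[of T' i T] assms by simp
  next
    case (step2 i)
    then show ?case using down[of T i T'] down[of T' i T] assms by simp
  qed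
qed

lemma renewal_enum:
  fixes W l
  assumes "\<And>n. \<exists>k\<in>renewal_times W l. n < k" and "\<And>n. \<exists>k\<in>renewal_times W l. k < n"
  shows "strict_mono (renewal_enum W l)" and "range (renewal_enum W l) = renewal_times W l"
proof -
  obtain T where T: "strict_mono T" "range T = renewal_times W l" "T 0 \<le> (0::int)" "0 < T (1::int)"
    using int_enumeration_exists[OF assms] by blast
  have "renewal_enum W l = T"
    unfolding renewal_enum_def
  proof (rule the_equality)
    fix S :: "int \<Rightarrow> int"
    assume "strict_mono S \<and> range S = renewal_times W l \<and> S 0 \<le> 0 \<and> 0 < S 1"
    then show "S = T" using T by (intro int_enumeration_unique) auto
  qed (use T in blast)
  with T show "strict_mono (renewal_enum W l)" "range (renewal_enum W l) = renewal_times W l"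
    by auto
qed

text \<open>This resolves the definite descriptions in \<open>nu_tilde\<close>: as \<open>s\<close>
  is the last renewal up to \<open>t\<close>, its index is the only one whose interval contains
  \<open>t\<close>.\<close>

lemma nu_tilde_last_renewal:
  assumes "\<And>n. \<exists>k\<in>renewal_times W l. n < k" and "\<And>n. \<exists>k\<in>renewal_times W l. k < n"
    and s: "s \<in> renewal_times W l" "s \<le> t" and last: "\<And>k. k \<in> renewal_times W l \<Longrightarrow> k \<le> t \<Longrightarrow> k \<le> s"
  shows "nu_tilde W l t = (if t = s then dirac 0 else sigma_shift (Psi_comp W s t (dirac 0)))"
proof -
  let ?T = "renewal_enum W l"
  note T = renewal_enum[OF assms(1,2)]
  obtain i where i: "s = ?T i" using s(1) T(2) by blast
  have next_gt: "t < ?T (i + 1)"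
  proof (rule ccontr)
    assume "\<not> t < ?T (i + 1)"
    then have "?T (i + 1) \<le> ?T i"
      using last[of "?T (i + 1)"] T(2) i by auto
    then show False using strict_mono_less_eq[OF T(1)] by simp
  qed
  have "(THE i. ?T i \<le> t \<and> t < ?T (i + 1)) = i"
  proof (rule the_equality)
    fix j assume j: "?T j \<le> t \<and> t < ?T (j + 1)"
    have "?T j < ?T (i + 1)" "?T i < ?T (j + 1)"
      using j next_gt s(2) i by auto
    then show "j = i" unfolding strict_mono_less[OF T(1)] by simp
  qed (use next_gt s i in auto)
  then show ?thesis by (simp add: nu_tilde_def Let_def i)
qed

text \<open>The renewal time \<open>s\<close> itself qualifies, and only finitely many integers lie
  between \<open>s\<close> and \<open>-1\<close>, so the supremum is a maximum.\<close>

lemma T_star_attained: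
  assumes s: "s \<in> renewal_times W l" "s \<le> -1"
  obtains u where "T_star W l = ereal (of_int u)" "s \<le> u" "u \<le> -1" "ereal l \<le> W u 1"
    "\<And>j. j \<in> {1..nat \<bar>u\<bar>} \<Longrightarrow> ereal (1 - l) \<le> wbar W u j"
proof -
  define P where "P t \<longleftrightarrow> t \<le> -1 \<and> ereal l \<le> W t 1 \<and> (\<forall>j\<in>{1..nat \<bar>t\<bar>}. ereal (1 - l) \<le> wbar W t j)" for t
  \<comment> \<open>For \<open>t \<le> -1\<close> the index set of \<open>Min\<close> is nonempty,
    so the bound unfolds to a bounded quantifier; for other \<open>t\<close> both sides are
    false.\<close>
  have P_iff: "t \<le> -1 \<and> W t 1 \<ge> ereal l \<and> Min (wbar W t ` {1..nat \<bar>t\<bar>}) \<ge> ereal (1 - l) \<longleftrightarrow> P t" for t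
    by (cases "t \<le> -1") (auto simp: P_def)
  have T: "T_star W l = Sup {ereal (of_int t) |t. P t}"
    unfolding T_star_def P_iff ..
  have "P s" using s by (auto simp: P_def renewal_times_def)
  define u where "u = Max {t. s \<le> t \<and> P t}"
  have fin: "finite {t. s \<le> t \<and> P t}"
    by (rule finite_subset[of _ "{s..-1}"]) (auto simp: P_def)
  have "u \<in> {t. s \<le> t \<and> P t}"
    unfolding u_def using \<open>P s\<close> fin by (intro Max_in) auto
  then have u: "s \<le> u" "P u" by auto
  have max: "t \<le> u" if "P t" for t
    using that u(1) fin by (cases "s \<le> t") (auto simp: u_def)
  have "T_star W l = ereal (of_int u)"
    unfolding T by (rule Sup_eqI) (use u max in auto)
  with u show ?thesis by (intro that) (auto simp: P_def)
qed

lemma m_bar_T_star: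
  assumes w: "\<And>t k. 1 \<le> k \<Longrightarrow> W t k \<le> 1" and l: "0 \<le> l" "l \<le> 1"
    and above: "\<And>n. \<exists>k\<in>renewal_times W l. n < k" and below: "\<And>n. \<exists>k\<in>renewal_times W l. k < n"
  shows "\<bar>T_star W l\<bar> < \<infinity>"
    and "m_bar W l 0 =
      max_shift (sigma_shift (Psi_comp W \<lfloor>real_of_ereal (T_star W l)\<rfloor> (-1) (dirac 0))) (W 0)"
proof -
  obtain k where k: "k \<in> renewal_times W l" "k < 0" using below by blast
  let ?K = "{t \<in> renewal_times W l. k \<le> t \<and> t \<le> -1}"
  have fin: "finite ?K" by (rule finite_subset[of _ "{k..-1}"]) auto
  define s where "s = Max ?K"
  have "s \<in> ?K" unfolding s_def using k fin by (intro Max_in) auto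
  then have s: "s \<in> renewal_times W l" "s \<le> -1" "k \<le> s" by auto
  have last: "t \<le> s" if "t \<in> renewal_times W l" "t \<le> -1" for t
    using that fin s(3) by (cases "k \<le> t") (auto simp: s_def)
  obtain u where T: "T_star W l = ereal (of_int u)" and u: "s \<le> u" "u \<le> -1" "ereal l \<le> W u 1"
    "\<And>j. j \<in> {1..nat \<bar>u\<bar>} \<Longrightarrow> ereal (1 - l) \<le> wbar W u j"
    using T_star_attained[OF s(1,2)] by blast
  show "\<bar>T_star W l\<bar> < \<infinity>" by (simp add: T)
  have "Psi_comp W s (- 1) (dirac 0) = pts (evolve W s (nat (- 1 - s)))"
    using Psi_comp_evolve[OF w l(2), where s = s and n = "nat (- 1 - s)"] s
    by (auto simp: renewal_times_def wbar_ge_iff)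
  then have idem: "sigma_shift (sigma_shift (Psi_comp W s (- 1) (dirac 0))) =
      sigma_shift (Psi_comp W s (- 1) (dirac 0))"
    by (simp only: sigma_shift_idem sorted_evolve)
  \<comment> \<open>If \<open>s = - 1\<close>, then \<open>nu_tilde\<close> is the unshifted
    \<open>dirac 0\<close> and the single shift comes from \<open>m_bar\<close>; if
    \<open>s < - 1\<close>, the shift occurs twice and collapses by \<open>idem\<close>.\<close>
  have Id: "s = - 1 \<Longrightarrow> Psi_comp W s (- 1) (dirac 0) = dirac 0"
    by (simp add: Psi_comp_def)
  have "m_bar W l 0 = max_shift (sigma_shift (Psi_comp W s (-1) (dirac 0))) (W 0)"
    using nu_tilde_last_renewal[OF above below s(1,2) last] Id
    by (auto simp: m_bar_def idem)
  also have "\<dots> = max_shift (sigma_shift (Psi_comp W u (-1) (dirac 0))) (W 0)"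
    using max_shift_renewal[OF w l s(1) _ u(2,3,4)] u(1) by (cases "s = u") auto
  finally show "m_bar W l 0 =
      max_shift (sigma_shift (Psi_comp W \<lfloor>real_of_ereal (T_star W l)\<rfloor> (-1) (dirac 0))) (W 0)"
    by (simp add: T)
qed

section \<open>Almost sure recurrence of renewals\<close>

text \<open>For \<open>0 \<le> x \<le> q\<close> one has
  \<open>1 - x \<ge> exp (- (x / (1 - q)))\<close>; with \<open>x = q ^ j\<close> the geometric
  series bounds the sum of the exponents. The result is uniform in \<open>m\<close>.\<close>

lemma prod_one_minus_power_ge:
  fixes q :: real
  assumes q: "0 \<le> q" "q < 1"
  shows "exp (- (1 / (1 - q)\<^sup>2)) \<le> (\<Prod>j = 1..m. 1 - q ^ j)"
proof -
  have one: "exp (- (q ^ j / (1 - q))) \<le> 1 - q ^ j" if "1 \<le> j" for j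
  proof -
    have x: "0 \<le> q ^ j" "q ^ j \<le> q"
      using q that power_decreasing[of 1 j q] by auto
    \<comment> \<open>With \<open>x = q ^ j\<close> the product equals
      \<open>1 + x * (q - x) / (1 - q)\<close>.\<close>
    have "1 \<le> (1 - q ^ j) * (1 + q ^ j / (1 - q))"
      using q x mult_left_mono[of "1 - q" "1 - q ^ j" "q ^ j"] by (simp add: field_simps)
    also have "\<dots> \<le> (1 - q ^ j) * exp (q ^ j / (1 - q))"
      using q x by (intro mult_left_mono exp_ge_add_one_self) auto
    finally show ?thesis by (simp add: exp_minus field_simps)
  qed
  have "(\<Sum>j = 1..m. q ^ j) \<le> (\<Sum>j. q ^ j)"
    using q by (intro sum_le_suminf summable_geometric) auto
  also have "\<dots> = 1 / (1 - q)"
    using q by (intro suminf_geometric) auto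
  finally have "(\<Sum>j = 1..m. q ^ j / (1 - q)) \<le> 1 / (1 - q)\<^sup>2"
    using q by (simp add: sum_divide_distrib[symmetric] power2_eq_square divide_right_mono flip: divide_divide_eq_left)
  then have "exp (- (1 / (1 - q)\<^sup>2)) \<le> exp (\<Sum>j = 1..m. - (q ^ j / (1 - q)))"
    by (simp add: sum_negf)
  also have "\<dots> = (\<Prod>j = 1..m. exp (- (q ^ j / (1 - q))))"
    by (simp add: exp_sum)
  also have "\<dots> \<le> (\<Prod>j = 1..m. 1 - q ^ j)"
    by (intro prod_mono) (auto intro: one)
  finally show ?thesis .
qed

text \<open>Every tail union has probability at least \<open>c\<close>, hence so has their
  decreasing limit, the limsup event; the zero-one law raises this to 1.\<close>

lemma (in prob_space) AE_infinite_indep_events: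
  fixes P :: "nat \<Rightarrow> 'a \<Rightarrow> bool"
  assumes ind: "indep_events (\<lambda>m. {x \<in> space M. P m x}) UNIV"
    and c: "0 < c" "\<And>m. c \<le> prob {x \<in> space M. P m x}"
  shows "AE x in M. infinite {m. P m x}"
proof -
  let ?F = "\<lambda>m. {x \<in> space M. P m x}"
  let ?L = "\<Inter>n. \<Union>m\<in>{n..}. ?F m"
  have ev[measurable]: "?F m \<in> events" for m
    using ind by (auto simp: indep_events_def)
  have "(\<lambda>n. prob (\<Union>m\<in>{n..}. ?F m)) \<longlonglongrightarrow> prob ?L"
    by (rule finite_Lim_measure_decseq) (force intro!: decseq_SucI)+
  moreover have "c \<le> prob (\<Union>m\<in>{n..}. ?F m)" for n
    using c(2)[of n] by (rule order_trans) (intro finite_measure_mono, auto)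
  ultimately have "c \<le> prob ?L"
    by (intro LIMSEQ_le_const) auto
  then have "prob ?L = 1"
    using borel_0_1_law[OF ind] c(1) by auto
  then have "AE x in M. x \<in> ?L"
    by (subst (asm) prob_eq_1) auto
  then show ?thesis
    by eventually_elim (auto simp: infinite_nat_iff_unbounded_le)
qed

text \<open>Splits a renewal at \<open>k\<close> into conditions that each involve the single row
  \<open>k + j\<close>, with \<open>j = 0\<close> standing for the requirement on
  \<open>W k 1\<close>. Distinct rows make them independent.\<close>

definition row_event :: "real \<Rightarrow> nat \<Rightarrow> (nat \<Rightarrow> ereal) \<Rightarrow> bool" where
  "row_event l j v \<longleftrightarrow> (if j = 0 then ereal l \<le> v 1 else \<exists>i\<in>{1..j}. ereal (1 - l) \<le> v i)"

lemma renewal_times_row_event: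
  "k \<in> renewal_times W l \<longleftrightarrow> (\<forall>j. row_event l j (W (k + int j)))"
proof -
  have "ereal (1 - l) \<le> wbar W k j \<longleftrightarrow> row_event l j (W (k + int j))" if "1 \<le> j" for j
    using that by (simp add: wbar_ge_iff row_event_def)
  moreover have "ereal l \<le> W k 1 \<longleftrightarrow> row_event l 0 (W (k + int 0))"
    by (simp add: row_event_def)
  ultimately show ?thesis
    unfolding renewal_times_def mem_Collect_eq by (metis less_one not_le)
qed

text \<open>Measurability on the partial product over \<open>K\<close> is what turns independence of
  blocks of rows into independence of events.\<close>

lemma measurable_row_event:
  assumes "{t} \<times> {1..} \<subseteq> K"
  shows "Measurable.pred (PiM K (\<lambda>_. borel)) (\<lambda>f. row_event l j (\<lambda>i. f (t, i)))"
proof -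
  have [measurable]: "(\<lambda>f. f (t, i)) \<in> borel_measurable (PiM K (\<lambda>_. borel))" if "i \<in> {1..}" for i
    using assms that by (intro measurable_component_singleton) auto
  show ?thesis unfolding row_event_def by (cases "j = 0") auto
qed

section \<open>Truncated renewals, zero-one law and Borel-Cantelli\<close>

context prob_space
begin

context
  fixes F :: "ereal measure" and l :: real and w :: "int \<Rightarrow> nat \<Rightarrow> 'a \<Rightarrow> ereal" and p q :: real
  assumes ind: "indep_vars (\<lambda>_. borel) (\<lambda>(t, j). w t j) (UNIV \<times> {1..})"
    and distr: "\<And>t j. j \<ge> 1 \<Longrightarrow> distr M borel (w t j) = F"
  defines "p \<equiv> measure F {ereal l..}" and "q \<equiv> measure F {..<ereal (1 - l)}"
  assumes p: "0 < p" and q: "q < 1"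
begin

lemma measurable_w: "1 \<le> j \<Longrightarrow> w t j \<in> borel_measurable M"
  using ind by (auto simp: indep_vars_def)

lemma prob_w:
  assumes "1 \<le> j" "A \<in> sets borel"
  shows "prob (w t j -` A \<inter> space M) = measure F A"
  using assms by (subst distr[symmetric, of j t]) (auto simp: measure_distr measurable_w)

lemma q_nonneg: "0 \<le> q"
  by (simp add: q_def)

lemma row_event_sets: "{\<omega> \<in> space M. row_event l j (\<lambda>i. w t i \<omega>)} \<in> events"
proof -
  have [measurable]: "w t i \<in> borel_measurable M" if "i \<in> {1..}" for i
    using that by (simp add: measurable_w)
  show ?thesis unfolding row_event_def by (cases "j = 0") auto
qed

lemma prob_not_row_event:
  assumes "1 \<le> j"
  shows "prob {\<omega> \<in> space M. \<not> row_event l j (\<lambda>i. w t i \<omega>)} = q ^ j"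
proof -
  let ?I = "{t} \<times> {1..j}"
  have "{\<omega> \<in> space M. \<not> row_event l j (\<lambda>i. w t i \<omega>)} =
      (\<Inter>x\<in>?I. (case x of (t, j) \<Rightarrow> w t j) -` {..<ereal (1 - l)} \<inter> space M)"
    using assms by (auto simp: row_event_def not_le)
  also have "prob \<dots> = (\<Prod>x\<in>?I. prob ((case x of (t, j) \<Rightarrow> w t j) -` {..<ereal (1 - l)} \<inter> space M))"
    using assms by (intro indep_varsD[OF ind]) auto
  also have "\<dots> = (\<Prod>x\<in>?I. q)"
    by (intro prod.cong) (auto simp: prob_w q_def)
  finally show ?thesis by simp
qed

lemma prob_row_event:
  "prob {\<omega> \<in> space M. row_event l j (\<lambda>i. w t i \<omega>)} = (if j = 0 then p else 1 - q ^ j)"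
proof (cases "j = 0")
  case True
  have "{\<omega> \<in> space M. row_event l 0 (\<lambda>i. w t i \<omega>)} = w t 1 -` {ereal l..} \<inter> space M"
    by (auto simp: row_event_def)
  then show ?thesis using True by (simp add: prob_w p_def)
next
  case False
  then show ?thesis
    using prob_not_row_event[of j t] prob_neg[OF row_event_sets[of j t]] by simp
qed

text \<open>Conditions for different \<open>j\<close> live on different rows, so their probabilities
  multiply. The bound depends on neither \<open>m\<close> nor \<open>k\<close>.\<close>

lemma prob_truncated_renewal_ge:
  "p * exp (- (1 / (1 - q)\<^sup>2)) \<le> prob {\<omega> \<in> space M. \<forall>j\<le>m. row_event l j (\<lambda>i. w (k + int j) i \<omega>)}"
proof -
  let ?K = "\<lambda>j. {k + int j} \<times> {1::nat..}"
  let ?E = "\<lambda>j. {\<omega> \<in> space M. row_event l j (\<lambda>i. w (k + int j) i \<omega>)}"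
  have "indep_vars (\<lambda>j. PiM (?K j) (\<lambda>_. borel)) (\<lambda>j \<omega>. restrict (\<lambda>x. (case x of (t, j) \<Rightarrow> w t j) \<omega>) (?K j)) UNIV"
    by (rule indep_vars_restrict[OF ind]) (auto simp: disjoint_family_on_def)
  then have "indep_events (\<lambda>j. {\<omega> \<in> space M. row_event l j
      (\<lambda>i. restrict (\<lambda>x. (case x of (t, j) \<Rightarrow> w t j) \<omega>) (?K j) (k + int j, i))}) UNIV"
    by (rule indep_eventsI_indep_vars) (rule measurable_row_event[unfolded pred_def], rule order_refl)
  \<comment> \<open>\<open>row_event\<close> reads only entries with index at least 1, all inside
    the block, so the restriction disappears.\<close>
  also have "(\<lambda>j. {\<omega> \<in> space M. row_event l j
      (\<lambda>i. restrict (\<lambda>x. (case x of (t, j) \<Rightarrow> w t j) \<omega>) (?K j) (k + int j, i))}) = ?E"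
    by (intro ext Collect_cong) (auto simp: row_event_def)
  finally have "prob (\<Inter>j\<in>{..m}. ?E j) = (\<Prod>j\<in>{..m}. prob (?E j))"
    by (auto simp: indep_events_def)
  also have "\<dots> = p * (\<Prod>j = 1..m. 1 - q ^ j)"
    by (simp add: prob_row_event prod.atMost_shift prod.atLeast1_atMost_eq)
  also have "(\<Inter>j\<in>{..m}. ?E j) = {\<omega> \<in> space M. \<forall>j\<le>m. row_event l j (\<lambda>i. w (k + int j) i \<omega>)}"
    by auto
  finally show ?thesis
    using p mult_left_mono[OF prod_one_minus_power_ge[OF q_nonneg q, of m], of p] by simp
qed

text \<open>The renewal at \<open>k m\<close> truncated at \<open>m\<close> depends on rows
  \<open>k m\<close> to \<open>k m + m\<close> only, so disjointness of these blocks makes the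
  events independent.\<close>

lemma AE_infinite_truncated_renewals:
  assumes "disjoint_family (\<lambda>m. {k m..k m + int m})"
  shows "AE \<omega> in M. infinite {m. \<forall>j\<le>m. row_event l j (\<lambda>i. w (k m + int j) i \<omega>)}"
proof (rule AE_infinite_indep_events)
  let ?K = "\<lambda>m. {k m..k m + int m} \<times> {1::nat..}"
  have "disjoint_family ?K"
    using assms unfolding disjoint_family_on_def by blast
  then have "indep_vars (\<lambda>m. PiM (?K m) (\<lambda>_. borel)) (\<lambda>m \<omega>. restrict (\<lambda>x. (case x of (t, j) \<Rightarrow> w t j) \<omega>) (?K m)) UNIV"
    by (intro indep_vars_restrict[OF ind]) auto
  then have "indep_events (\<lambda>m. {\<omega> \<in> space M. \<forall>j\<in>{..m}. row_event l j
      (\<lambda>i. restrict (\<lambda>x. (case x of (t, j) \<Rightarrow> w t j) \<omega>) (?K m) (k m + int j, i))}) UNIV"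
  proof (rule indep_eventsI_indep_vars)
    fix m
    have [measurable]: "Measurable.pred (PiM (?K m) (\<lambda>_. borel)) (\<lambda>f. row_event l j (\<lambda>i. f (k m + int j, i)))"
      if "j \<in> {..m}" for j
      using that by (intro measurable_row_event) auto
    show "{f \<in> space (PiM (?K m) (\<lambda>_. borel)). \<forall>j\<in>{..m}. row_event l j (\<lambda>i. f (k m + int j, i))}
        \<in> sets (PiM (?K m) (\<lambda>_. borel))"
      by measurable
  qed
  also have "(\<lambda>m. {\<omega> \<in> space M. \<forall>j\<in>{..m}. row_event l j
      (\<lambda>i. restrict (\<lambda>x. (case x of (t, j) \<Rightarrow> w t j) \<omega>) (?K m) (k m + int j, i))}) =
      (\<lambda>m. {\<omega> \<in> space M. \<forall>j\<le>m. row_event l j (\<lambda>i. w (k m + int j) i \<omega>)})"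
    by (intro ext Collect_cong) (auto simp: row_event_def)
  finally show "indep_events (\<lambda>m. {\<omega> \<in> space M. \<forall>j\<le>m. row_event l j (\<lambda>i. w (k m + int j) i \<omega>)}) UNIV" .
  show "0 < p * exp (- (1 / (1 - q)\<^sup>2))" using p by simp
qed (rule prob_truncated_renewal_ge)

text \<open>Condition \<open>j\<close> fails with probability \<open>q ^ j\<close>, so by the union
  bound some condition with \<open>j > m\<close> fails with probability at most
  \<open>q ^ (m + 1) / (1 - q)\<close>. This is summable in \<open>m\<close>, and the first
  Borel-Cantelli lemma applies.\<close>

lemma AE_eventually_no_late_failure:
  "AE \<omega> in M. eventually (\<lambda>m. \<forall>j>m. row_event l j (\<lambda>i. w (k m + int j) i \<omega>)) sequentially"
proof -
  \<comment> \<open>Writing \<open>j = i + m + 1\<close> lets \<open>i\<close> run over all naturals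
    exactly when \<open>j\<close> runs over the late conditions.\<close>
  let ?C = "\<lambda>m i. {\<omega> \<in> space M. \<not> row_event l (i + Suc m) (\<lambda>n. w (k m + int (i + Suc m)) n \<omega>)}"
  have C: "?C m i \<in> events" for m i
    using sets.compl_sets[OF row_event_sets[of "i + Suc m" "k m + int (i + Suc m)"]]
    by (rule back_subst[of "\<lambda>A. A \<in> events"]) auto
  have pC: "prob (?C m i) = q ^ i * q ^ Suc m" for m i
    by (subst prob_not_row_event) (simp_all add: power_add)
  have geo: "(\<lambda>i. q ^ i * c) sums (1 / (1 - q) * c)" for c
    using q q_nonneg by (intro sums_mult2 geometric_sums) auto
  have "prob (\<Union>i. ?C m i) \<le> (\<Sum>i. prob (?C m i))" for m
    using C geo by (intro finite_measure_subadditive_countably) (auto simp only: pC sums_iff)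
  then have le: "prob (\<Union>i. ?C m i) \<le> q ^ m * (1 / (1 - q) * q)" for m
    using geo[THEN sums_unique, symmetric] by (simp only: pC) (simp add: mult_ac)
  have "AE \<omega> in M. eventually (\<lambda>m. \<omega> \<in> space M - (\<Union>i. ?C m i)) sequentially"
  proof (rule borel_cantelli_AE1)
    show "summable (\<lambda>m. prob (\<Union>i. ?C m i))"
    proof (rule summable_comparison_test'[where N = 0])
      show "summable (\<lambda>m. q ^ m * (1 / (1 - q) * q))" by (rule geo[THEN sums_summable])
      show "norm (prob (\<Union>i. ?C m i)) \<le> q ^ m * (1 / (1 - q) * q)" for m
        unfolding real_norm_def abs_of_nonneg[OF measure_nonneg] by (rule le)
    qed
  next
    show "(\<Union>i. ?C m i) \<in> events" for m
      by (rule sets.countable_UN''[OF countableI_type C])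
    show "emeasure M (\<Union>i. ?C m i) < \<infinity>" for m
      unfolding infinity_ennreal_def less_top[symmetric] by (rule emeasure_finite)
  qed
  then show ?thesis
  proof eventually_elim
    case (elim \<omega>)
    then show ?case
    proof eventually_elim
      case (elim m)
      show ?case
      proof (intro allI impI)
        fix j assume "m < j"
        then have j: "j = (j - Suc m) + Suc m" by simp
        have "\<omega> \<in> space M" "\<omega> \<notin> ?C m (j - Suc m)" using elim by blast+
        then have "row_event l (j - Suc m + Suc m) (\<lambda>i. w (k m + int (j - Suc m + Suc m)) i \<omega>)" by blast
        then show "row_event l j (\<lambda>i. w (k m + int j) i \<omega>)" by (simp only: j[symmetric])
      qed
    qed
  qed
qed

text \<open>Beyond the index from which no late condition fails, every truncated renewal is a full
  one.\<close>

lemma AE_infinite_renewals: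
  assumes "disjoint_family (\<lambda>m. {k m..k m + int m})"
  shows "AE \<omega> in M. infinite {m. k m \<in> renewal_times (\<lambda>t j. w t j \<omega>) l}"
  using AE_infinite_truncated_renewals[OF assms] AE_eventually_no_late_failure[of k]
proof eventually_elim
  case (elim \<omega>)
  from elim(2) obtain N where N: "\<And>m j. N \<le> m \<Longrightarrow> m < j \<Longrightarrow> row_event l j (\<lambda>i. w (k m + int j) i \<omega>)"
    by (auto simp: eventually_sequentially)
  show ?case
    unfolding infinite_nat_iff_unbounded_le
  proof
    fix n
    obtain m where m: "max n N \<le> m" "\<forall>j\<le>m. row_event l j (\<lambda>i. w (k m + int j) i \<omega>)"
      using elim(1) unfolding infinite_nat_iff_unbounded_le by blast
    have "row_event l j (\<lambda>i. w (k m + int j) i \<omega>)" for j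
      using m N[of m j] by (cases "j \<le> m") auto
    then show "\<exists>m\<ge>n. m \<in> {m. k m \<in> renewal_times (\<lambda>t j. w t j \<omega>) l}"
      using m(1) by (auto simp: renewal_times_row_event)
  qed
qed

lemma AE_renewals_unbounded:
  "AE \<omega> in M. (\<forall>n. \<exists>k\<in>renewal_times (\<lambda>t j. w t j \<omega>) l. n < k) \<and>
    (\<forall>n. \<exists>k\<in>renewal_times (\<lambda>t j. w t j \<omega>) l. k < n)"
proof -
  \<comment> \<open>A block of \<open>m\<close> further integers after the square of
    \<open>m\<close> ends before the next square.\<close>
  have sq: "int m * int m + int m < int m' * int m'" if "m < m'" for m m'
  proof -
    have "int m * int m + int m < (int m + 1) * (int m + 1)" by (simp add: algebra_simps)
    also have "\<dots> \<le> int m' * int m'" using that by (intro mult_mono) auto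
    finally show ?thesis .
  qed
  have disj: "disjoint_family (\<lambda>m. {k m..k m + int m})"
    if "\<And>m m'. m < m' \<Longrightarrow> {k m..k m + int m} \<inter> {k m'..k m' + int m'} = {}" for k
    unfolding disjoint_family_on_def using that by (metis Int_commute nat_neq_iff)
  have up: "disjoint_family (\<lambda>m. {int (Suc m) * int (Suc m)..int (Suc m) * int (Suc m) + int m})"
  proof (rule disj)
    fix m m' :: nat assume "m < m'"
    then show "{int (Suc m) * int (Suc m)..int (Suc m) * int (Suc m) + int m} \<inter>
        {int (Suc m') * int (Suc m')..int (Suc m') * int (Suc m') + int m'} = {}"
      using sq[of "Suc m" "Suc m'"] by auto
  qed
  have down: "disjoint_family (\<lambda>m. {- (int (Suc m) * int (Suc m))..- (int (Suc m) * int (Suc m)) + int m})"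
  proof (rule disj)
    fix m m' :: nat assume "m < m'"
    \<comment> \<open>The block of \<open>m'\<close> ends at \<open>- (m' * m' + m' + 1)\<close>,
      which therefore lies below the start of the block of \<open>m\<close>.\<close>
    then have "int (Suc m) * int (Suc m) \<le> int m' * int m'" by (intro mult_mono) auto
    then show "{- (int (Suc m) * int (Suc m))..- (int (Suc m) * int (Suc m)) + int m} \<inter>
        {- (int (Suc m') * int (Suc m'))..- (int (Suc m') * int (Suc m')) + int m'} = {}"
      by (auto simp: algebra_simps)
  qed
  \<comment> \<open>The chosen positions exceed \<open>m\<close> in absolute value, so infinitely
    many successful \<open>m\<close> yield renewals arbitrarily far out.\<close>
  have big: "int m < int (Suc m) * int (Suc m)" for m
    by (simp add: algebra_simps add_pos_nonneg)
  show ?thesis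
    using AE_infinite_renewals[OF up] AE_infinite_renewals[OF down]
  proof eventually_elim
    case (elim \<omega>)
    let ?J = "renewal_times (\<lambda>t j. w t j \<omega>) l"
    have "\<exists>k\<in>?J. n < k" for n
    proof -
      obtain m where "nat \<bar>n\<bar> \<le> m" "int (Suc m) * int (Suc m) \<in> ?J"
        using elim(1) unfolding infinite_nat_iff_unbounded_le by blast
      then show ?thesis using big[of m] by (intro bexI[of _ "int (Suc m) * int (Suc m)"]) auto
    qed
    moreover have "\<exists>k\<in>?J. k < n" for n
    proof -
      obtain m where "nat \<bar>n\<bar> \<le> m" "- (int (Suc m) * int (Suc m)) \<in> ?J"
        using elim(2) unfolding infinite_nat_iff_unbounded_le by blast
      then show ?thesis using big[of m] by (intro bexI[of _ "- (int (Suc m) * int (Suc m))"]) auto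
    qed
    ultimately show ?case by blast
  qed
qed

end

end

text \<open>The infimum is attained: along a sequence of admissible points converging to
  \<open>b\<close>, countably many null sets cover \<open>{b<..}\<close>.\<close>

lemma emeasure_greaterThan_Inf:
  fixes F :: "ereal measure"
  assumes "sets F = sets borel"
  defines "b \<equiv> Inf {z. emeasure F {z<..} = 0}"
  shows "emeasure F {b<..} = 0"
proof -
  \<comment> \<open>The set is nonempty because it contains \<open>\<infinity>\<close>, above which
    nothing lies.\<close>
  obtain z where z: "\<And>n. z n \<in> {z. emeasure F {z<..} = 0}" "z \<longlonglongrightarrow> b"
    using Inf_as_limit[of "{z. emeasure F {z<..} = 0}"] unfolding b_def
    by (metis (mono_tags, lifting) emeasure_empty empty_iff ereal_less_eq(1) greaterThan_def
        mem_Collect_eq not_le Collect_empty_eq)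
  have "{b<..} \<subseteq> (\<Union>n. {z n<..})"
  proof
    fix x assume "x \<in> {b<..}"
    then have "eventually (\<lambda>n. z n < x) sequentially"
      using z(2) by (auto intro: order_tendstoD)
    then show "x \<in> (\<Union>n. {z n<..})"
      by (auto dest: eventually_happens)
  qed
  moreover have "(\<Union>n. {z n<..}) \<in> null_sets F"
    using z(1) assms(1) by (intro null_sets_UN) (auto simp: null_sets_def)
  ultimately show ?thesis
    using assms(1) by (metis emeasure_eq_0 null_setsD1 null_setsD2)
qed

section \<open>Proof of the theorem\<close>

theorem theorem10p7:
  fixes M :: "'a measure" and F :: "ereal measure" and l :: real
    and w :: "int \<Rightarrow> nat \<Rightarrow> 'a \<Rightarrow> ereal"
  assumes "prob_space F" and "sets F = sets borel" and "emeasure F {\<infinity>} = 0"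
    and "Inf {z. emeasure F {z<..} = 0} = 1"
    and "0 \<le> l" and "l < 1"
    and "emeasure F {ereal (1 - l)..1} > 0" and "emeasure F {ereal l..1} > 0"
    and "prob_space M"
    and "prob_space.indep_vars M (\<lambda>_. borel) (\<lambda>(t, j). w t j) (UNIV \<times> {1..})"
    and "\<And>t j. j \<ge> 1 \<Longrightarrow> distr M borel (w t j) = F"
  shows "(AE \<omega> in M. \<bar>T_star (\<lambda>t j. w t j \<omega>) l\<bar> < \<infinity>) \<and>
    (AE \<omega> in M. let W = (\<lambda>t j. w t j \<omega>) in
       m_bar W l 0 =
       max_shift (sigma_shift (Psi_comp W \<lfloor>real_of_ereal (T_star W l)\<rfloor> (-1) (dirac 0))) (W 0))"
proof -
  interpret M: prob_space M by fact
  interpret F: prob_space F by fact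
  note sets = \<open>sets F = sets borel\<close>
  have "emeasure F {ereal l..1} \<le> emeasure F {ereal l..}"
    using sets by (intro emeasure_mono) auto
  with \<open>emeasure F {ereal l..1} > 0\<close> have p: "0 < measure F {ereal l..}"
    by (auto simp: F.emeasure_eq_measure)
  \<comment> \<open>The interval from \<open>1 - l\<close> to 1 has positive mass and is disjoint
    from the values below \<open>1 - l\<close>, which forces \<open>q < 1\<close>.\<close>
  have "measure F {..<ereal (1 - l)} + measure F {ereal (1 - l)..1} =
      measure F ({..<ereal (1 - l)} \<union> {ereal (1 - l)..1})"
    using sets by (intro F.finite_measure_Union[symmetric]) auto
  also have "\<dots> \<le> 1" by (rule F.prob_le_1)
  finally have q: "measure F {..<ereal (1 - l)} < 1"
    using \<open>emeasure F {ereal (1 - l)..1} > 0\<close> by (simp add: F.emeasure_eq_measure)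
  have renewals: "AE \<omega> in M. (\<forall>n. \<exists>k\<in>renewal_times (\<lambda>t j. w t j \<omega>) l. n < k) \<and>
      (\<forall>n. \<exists>k\<in>renewal_times (\<lambda>t j. w t j \<omega>) l. k < n)"
    by (rule M.AE_renewals_unbounded[OF assms(10) _ p q]) (rule assms(11))
  have le: "AE \<omega> in M. w t j \<omega> \<le> 1" if "1 \<le> j" for t j
  proof -
    have w: "w t j \<in> borel_measurable M"
      using assms(10) that by (auto simp: M.indep_vars_def)
    have "AE x in F. \<not> 1 < x"
      using emeasure_greaterThan_Inf[OF sets] sets assms(4)
      by (intro AE_I[of _ _ "{1<..}"]) auto
    then have "AE x in distr M borel (w t j). x \<le> 1"
      unfolding assms(11)[OF that, of t] not_less .
    then show ?thesis
      using w by (subst (asm) AE_distr_iff) auto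
  qed
  \<comment> \<open>The bound by 1 holds off a null set for each pair of indices; there are
    countably many pairs, so it holds simultaneously, as the pathwise argument requires.\<close>
  have "AE \<omega> in M. \<forall>t. \<forall>j\<in>{1..}. w t j \<omega> \<le> 1"
    unfolding AE_all_countable using le by (intro allI AE_ball_countable') auto
  then have "AE \<omega> in M. \<bar>T_star (\<lambda>t j. w t j \<omega>) l\<bar> < \<infinity> \<and>
    m_bar (\<lambda>t j. w t j \<omega>) l 0 =
      max_shift (sigma_shift (Psi_comp (\<lambda>t j. w t j \<omega>)
        \<lfloor>real_of_ereal (T_star (\<lambda>t j. w t j \<omega>) l)\<rfloor> (-1) (dirac 0))) (\<lambda>j. w 0 j \<omega>)"
    using renewals
  proof eventually_elim
    case (elim \<omega>)
    show ?case
      using m_bar_T_star[of "\<lambda>t j. w t j \<omega>" l] elim assms(5,6) by auto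
  qed
  then show ?thesis
    by (simp add: Let_def)
qed

end
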